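(* Let $I=[0,T]$ with $T>0$ and consider the periodic boundary value problem $$u'(t)=f(t,u(t))\quad(t\in I),\qquad u(0)=u(T),$$ where $f:I\times\mathbb{R}\to\mathbb{R}$ is a Carathéodory function such that $f(t,s)$ is bounded in $t\in I$ (i.e. for each $s\in\mathbb{R}$ the function $t\mapsto f(t,s)$ is bounded on $I$). Suppose there exist $\alpha>0$ and a function $h:I\to(0,\infty)$ such that $\sup_{t\in I}h(t)<\alpha$ and $$0\le f(t,s_2)+\alpha s_2-\big(f(t,s_1)+\alpha s_1\big)\le h(t)(s_2-s_1)$$ for all $t\in I$ and all $s_1,s_2\in\mathbb{R}$ with $s_1\le s_2$. If the problem has a lower solution, then there exists a unique solution for it.
   Context: $AC(I)$ is the set of real valued absolutely continuous functions on $I$. A function $f:I\times\mathbb{R}\to\mathbb{R}$ is Carathéodory if $f(\cdot,s)$ is measurable for each fixed $s\in\mathbb{R}$ and $f(t,\cdot)$ is continuous for each fixed $t\in I$. A solution is a function $u\in AC(I)$ with $u'(t)=f(t,u(t))$ for a.e. $t\in I$ and $u(0)=u(T)$. A lower solution is a function $w\in AC(I)$ with $w'(t)\le f(t,w(t))$ for a.e. $t\in I$ and $w(0)\le w(T)$. *)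

theory Defs
  imports "HOL-Analysis.Analysis"
begin

text \<open>
  The epsilon-delta definition over finite families of non-overlapping subintervals
  of \<open>S\<close> (an interval), each represented by its pair of endpoints. Degenerate pairs
  \<open>(c, c)\<close> are allowed and contribute nothing. Not to be confused with the
  library's \<open>absolutely_continuous\<close>, which is a relation between measures.
\<close>
definition abs_continuous_on :: "real set \<Rightarrow> (real \<Rightarrow> real) \<Rightarrow> bool" where
  "abs_continuous_on S u \<longleftrightarrow>
    (\<forall>\<epsilon>>0. \<exists>\<delta>>0. \<forall>F.
       finite F \<and> (\<forall>(c, d)\<in>F. c \<le> d \<and> {c..d} \<subseteq> S) \<and>
       disjoint_family_on (\<lambda>(c, d). {c<..<d}) F \<and>
       (\<Sum>(c, d)\<in>F. d - c) < \<delta>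
       \<longrightarrow> (\<Sum>(c, d)\<in>F. \<bar>u d - u c\<bar>) < \<epsilon>)"

definition caratheodory_on :: "real set \<Rightarrow> (real \<Rightarrow> real \<Rightarrow> real) \<Rightarrow> bool" where
  "caratheodory_on S f \<longleftrightarrow>
    (\<forall>s. (\<lambda>t. f t s) \<in> borel_measurable (lebesgue_on S)) \<and>
    (\<forall>t\<in>S. continuous_on UNIV (f t))"

text \<open>
  Functions on \<open>[0, T]\<close> are represented by total functions on the reals; taking
  derivatives within \<open>[0, T]\<close> makes the notions below independent of the
  values outside that interval.
\<close>
definition periodic_solution :: "real \<Rightarrow> (real \<Rightarrow> real \<Rightarrow> real) \<Rightarrow> (real \<Rightarrow> real) \<Rightarrow> bool" where
  "periodic_solution T f u \<longleftrightarrow>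
    abs_continuous_on {0..T} u \<and>
    (AE t in lebesgue_on {0..T}. (u has_real_derivative f t (u t)) (at t within {0..T})) \<and>
    u 0 = u T"

definition periodic_lower_solution :: "real \<Rightarrow> (real \<Rightarrow> real \<Rightarrow> real) \<Rightarrow> (real \<Rightarrow> real) \<Rightarrow> bool" where
  "periodic_lower_solution T f w \<longleftrightarrow>
    abs_continuous_on {0..T} w \<and>
    (AE t in lebesgue_on {0..T}.
       \<exists>D. (w has_real_derivative D) (at t within {0..T}) \<and> D \<le> f t (w t)) \<and>
    w 0 \<le> w T"

end

theory Submission
  imports Defs
begin

text \<open>
  Write \<open>g t s = f t s + \<alpha> * s\<close>, which is Lipschitz in \<open>s\<close> with constant \<open>k = sup h < \<alpha>\<close>. A solution is
  a fixed point of the map sending \<open>u\<close> to the unique periodic solution of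
  \<open>v' + \<alpha> v = g t (u t)\<close>. The Green's function of this linear problem is positive with integral
  \<open>1 / \<alpha>\<close>, so the map is a contraction in the supremum norm with factor \<open>k / \<alpha>\<close>. For
  uniqueness, the square of the difference of two solutions has derivative at most \<open>-2 (\<alpha> - k)\<close> times
  itself; it is therefore nonincreasing, hence constant by periodicity, hence zero.
\<close>

section \<open>Absolutely continuous functions\<close>

text \<open>The differential equation holds only almost everywhere, so each half rests on a theorem
  of Lebesgue theory. For existence, an indefinite integral must have its integrand as derivative
  off a null set. For uniqueness, a nonpositive derivative off a null set must prevent growth;
  continuity alone does not give this, since the Cantor function increases with derivative 0 almost
  everywhere, and this is where absolute continuity enters. Both facts are proved with gauges: the
  first by Henstock's lemma, the second by a fine tagged division. The gap between \<open>k\<close>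
  and \<open>\<alpha>\<close> is used twice. It gives the contraction factor
  \<open>k / \<alpha> < 1\<close>, and it makes \<open>f\<close> itself strictly dissipative with
  rate \<open>\<alpha> - k\<close>.\<close>

text \<open>Lebesgue measure is complete, so the exceptional set is itself null and not merely
  contained in a null set.\<close>

lemma AE_lebesgue_on_iff_negligible:
  assumes "S \<in> sets lebesgue"
  shows "(AE x in lebesgue_on S. P x) \<longleftrightarrow> negligible {x \<in> S. \<not> P x}"
proof -
  have "(AE x in lebesgue_on S. P x) \<longleftrightarrow> (AE x in lebesgue. x \<in> S \<longrightarrow> P x)"
    using assms by (simp add: AE_restrict_space_iff)
  also have "\<dots> \<longleftrightarrow> (\<exists>N. negligible N \<and> {x \<in> S. \<not> P x} \<subseteq> N)"
    by (auto simp: eventually_ae_filter negligible_iff_null_sets Bex_def)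
  also have "\<dots> \<longleftrightarrow> negligible {x \<in> S. \<not> P x}"
    using negligible_subset by blast
  finally show ?thesis .
qed

lemma negligible_outer_open:
  fixes N :: "'a::euclidean_space set"
  assumes "negligible N" "e > 0"
  obtains U where "open U" "N \<subseteq> U" "U \<in> lmeasurable" "measure lebesgue U < e"
proof -
  have N: "N \<in> null_sets lebesgue"
    using assms negligible_iff_null_sets by blast
  obtain U where U: "open U" "N \<subseteq> U" "U - N \<in> lmeasurable" "emeasure lebesgue (U - N) < ennreal e"
    using sets_lebesgue_outer_open [of N e] N assms by blast
  have eq: "emeasure lebesgue (U - N) = emeasure lebesgue U"
    using N U(1) by (intro emeasure_Diff_null_set) auto
  then have "emeasure lebesgue U < ennreal e"
    using U by simp
  moreover from this have "U \<in> lmeasurable"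
    using U(1) by (intro fmeasurableI) (auto intro: less_trans)
  moreover from this have "emeasure lebesgue U = ennreal (measure lebesgue U)"
    by (simp add: emeasure_eq_measure2)
  ultimately have "measure lebesgue U < e"
    using ennreal_less_iff by force
  with that U \<open>U \<in> lmeasurable\<close> show thesis by blast
qed

lemma abs_continuous_onD:
  assumes "abs_continuous_on S u" "\<epsilon> > 0"
  obtains \<delta> where "\<delta> > 0" "\<And>F. \<lbrakk>finite F; \<And>c d. (c, d) \<in> F \<Longrightarrow> c \<le> d \<and> {c..d} \<subseteq> S;
       disjoint_family_on (\<lambda>(c, d). {c<..<d}) F; (\<Sum>(c, d)\<in>F. d - c) < \<delta>\<rbrakk>
       \<Longrightarrow> (\<Sum>(c, d)\<in>F. \<bar>u d - u c\<bar>) < \<epsilon>"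
proof -
  obtain \<delta> where "\<delta> > 0" and \<delta>: "\<forall>F. finite F \<and> (\<forall>(c, d)\<in>F. c \<le> d \<and> {c..d} \<subseteq> S) \<and>
       disjoint_family_on (\<lambda>(c, d). {c<..<d}) F \<and> (\<Sum>(c, d)\<in>F. d - c) < \<delta>
       \<longrightarrow> (\<Sum>(c, d)\<in>F. \<bar>u d - u c\<bar>) < \<epsilon>"
    using assms unfolding abs_continuous_on_def by blast
  show thesis
    by (rule that [OF \<open>\<delta> > 0\<close>], rule \<delta> [rule_format]) auto
qed

lemma abs_continuous_on_subset:
  assumes "abs_continuous_on S u" "T \<subseteq> S"
  shows "abs_continuous_on T u"
  unfolding abs_continuous_on_def
proof (intro allI impI)
  fix \<epsilon> :: real assume "\<epsilon> > 0"
  then obtain \<delta> where "\<delta> > 0" and \<delta>: "\<And>F. \<lbrakk>finite F; \<And>c d. (c, d) \<in> F \<Longrightarrow> c \<le> d \<and> {c..d} \<subseteq> S;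
       disjoint_family_on (\<lambda>(c, d). {c<..<d}) F; (\<Sum>(c, d)\<in>F. d - c) < \<delta>\<rbrakk>
       \<Longrightarrow> (\<Sum>(c, d)\<in>F. \<bar>u d - u c\<bar>) < \<epsilon>"
    using abs_continuous_onD [OF assms(1)] by metis
  show "\<exists>\<delta>>0. \<forall>F. finite F \<and> (\<forall>(c, d)\<in>F. c \<le> d \<and> {c..d} \<subseteq> T) \<and>
       disjoint_family_on (\<lambda>(c, d). {c<..<d}) F \<and> (\<Sum>(c, d)\<in>F. d - c) < \<delta>
       \<longrightarrow> (\<Sum>(c, d)\<in>F. \<bar>u d - u c\<bar>) < \<epsilon>"
    using \<open>\<delta> > 0\<close> assms(2) by (intro exI [of _ \<delta>] conjI allI impI \<delta>) fastforce+
qed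

text \<open>A common source for the closure properties: Lipschitz functions are dominated by the
  identity, differences and products by their two operands.\<close>

lemma abs_continuous_on_dominated:
  assumes u: "abs_continuous_on S u" and v: "abs_continuous_on S v"
    and w: "\<And>c d. \<lbrakk>c \<in> S; d \<in> S; c \<le> d\<rbrakk> \<Longrightarrow> \<bar>w d - w c\<bar> \<le> M * (\<bar>u d - u c\<bar> + \<bar>v d - v c\<bar>)"
  shows "abs_continuous_on S w"
  unfolding abs_continuous_on_def
proof (intro allI impI)
  fix \<epsilon> :: real assume "\<epsilon> > 0"
  \<comment> \<open>\<open>M\<close> carries no sign condition; \<open>L\<close> is a positive
    constant above it, so that dividing by \<open>L\<close> and scaling strict inequalities by it
    are legitimate.\<close>
  define L where "L = \<bar>M\<bar> + 1"
  have L: "L > 0" "M \<le> L"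
    by (auto simp: L_def)
  define \<eta> where "\<eta> = \<epsilon> / (2 * L)"
  have "\<eta> > 0"
    using L \<open>\<epsilon> > 0\<close> by (simp add: \<eta>_def)
  obtain \<delta> where "\<delta> > 0" and \<delta>: "\<And>F. \<lbrakk>finite F; \<And>c d. (c, d) \<in> F \<Longrightarrow> c \<le> d \<and> {c..d} \<subseteq> S;
       disjoint_family_on (\<lambda>(c, d). {c<..<d}) F; (\<Sum>(c, d)\<in>F. d - c) < \<delta>\<rbrakk>
       \<Longrightarrow> (\<Sum>(c, d)\<in>F. \<bar>u d - u c\<bar>) < \<eta>"
    using abs_continuous_onD [OF u \<open>\<eta> > 0\<close>] by metis
  obtain \<delta>' where "\<delta>' > 0" and \<delta>': "\<And>F. \<lbrakk>finite F; \<And>c d. (c, d) \<in> F \<Longrightarrow> c \<le> d \<and> {c..d} \<subseteq> S;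
       disjoint_family_on (\<lambda>(c, d). {c<..<d}) F; (\<Sum>(c, d)\<in>F. d - c) < \<delta>'\<rbrakk>
       \<Longrightarrow> (\<Sum>(c, d)\<in>F. \<bar>v d - v c\<bar>) < \<eta>"
    using abs_continuous_onD [OF v \<open>\<eta> > 0\<close>] by metis
  show "\<exists>\<delta>>0. \<forall>F. finite F \<and> (\<forall>(c, d)\<in>F. c \<le> d \<and> {c..d} \<subseteq> S) \<and>
       disjoint_family_on (\<lambda>(c, d). {c<..<d}) F \<and> (\<Sum>(c, d)\<in>F. d - c) < \<delta>
       \<longrightarrow> (\<Sum>(c, d)\<in>F. \<bar>w d - w c\<bar>) < \<epsilon>"
  proof (intro exI [of _ "min \<delta> \<delta>'"] conjI allI impI)
    fix F assume F: "finite F \<and> (\<forall>(c, d)\<in>F. c \<le> d \<and> {c..d} \<subseteq> S) \<and>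
       disjoint_family_on (\<lambda>(c, d). {c<..<d}) F \<and> (\<Sum>(c, d)\<in>F. d - c) < min \<delta> \<delta>'"
    have *: "\<bar>w d - w c\<bar> \<le> L * (\<bar>u d - u c\<bar> + \<bar>v d - v c\<bar>)" if "(c, d) \<in> F" for c d
    proof -
      have "c \<in> S" "d \<in> S" "c \<le> d"
        using F that by fastforce+
      then have "\<bar>w d - w c\<bar> \<le> M * (\<bar>u d - u c\<bar> + \<bar>v d - v c\<bar>)"
        by (rule w)
      also have "\<dots> \<le> L * (\<bar>u d - u c\<bar> + \<bar>v d - v c\<bar>)"
        using L by (intro mult_right_mono) auto
      finally show ?thesis .
    qed
    have "(\<Sum>(c, d)\<in>F. \<bar>w d - w c\<bar>) \<le> (\<Sum>(c, d)\<in>F. L * (\<bar>u d - u c\<bar> + \<bar>v d - v c\<bar>))"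
      using * by (intro sum_mono) auto
    also have "\<dots> = L * ((\<Sum>(c, d)\<in>F. \<bar>u d - u c\<bar>) + (\<Sum>(c, d)\<in>F. \<bar>v d - v c\<bar>))"
      by (simp add: sum_distrib_left sum.distrib split_def distrib_left)
    also have "\<dots> < L * (\<eta> + \<eta>)"
      using F L by (intro mult_strict_left_mono add_strict_mono \<delta> \<delta>') auto
    also have "\<dots> = \<epsilon>"
      using L by (simp add: \<eta>_def field_simps)
    finally show "(\<Sum>(c, d)\<in>F. \<bar>w d - w c\<bar>) < \<epsilon>" .
  qed (use \<open>\<delta> > 0\<close> \<open>\<delta>' > 0\<close> in auto)
qed

lemma abs_continuous_on_id: "abs_continuous_on S (\<lambda>x. x)"
  unfolding abs_continuous_on_def
proof (intro allI impI)
  fix \<epsilon> :: real assume "\<epsilon> > 0"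
  have "(\<Sum>(c, d)\<in>F. \<bar>d - c\<bar>) = (\<Sum>(c, d)\<in>F. d - c)" if "\<forall>(c, d)\<in>F. c \<le> d \<and> {c..d} \<subseteq> S" for F
    using that by (intro sum.cong) auto
  then show "\<exists>\<delta>>0. \<forall>F. finite F \<and> (\<forall>(c, d)\<in>F. c \<le> d \<and> {c..d} \<subseteq> S) \<and>
       disjoint_family_on (\<lambda>(c, d). {c<..<d}) F \<and> (\<Sum>(c, d)\<in>F. d - c) < \<delta>
       \<longrightarrow> (\<Sum>(c, d)\<in>F. \<bar>d - c\<bar>) < \<epsilon>"
    using \<open>\<epsilon> > 0\<close> by (intro exI [of _ \<epsilon>]) auto
qed

lemma lipschitz_on_imp_abs_continuous_on:
  fixes u :: "real \<Rightarrow> real"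
  assumes "L-lipschitz_on S u"
  shows "abs_continuous_on S u"
proof (rule abs_continuous_on_dominated [OF abs_continuous_on_id abs_continuous_on_id])
  fix c d assume "c \<in> S" "d \<in> S" "c \<le> d"
  then have "\<bar>u d - u c\<bar> \<le> L * \<bar>d - c\<bar>"
    using lipschitz_onD [OF assms, of d c] by (simp add: dist_real_def)
  \<comment> \<open>Half of \<open>L\<close>, because the identity serves as both dominating
    functions.\<close>
  then show "\<bar>u d - u c\<bar> \<le> (L / 2) * (\<bar>d - c\<bar> + \<bar>d - c\<bar>)"
    by simp
qed

lemma abs_continuous_on_imp_continuous_on:
  assumes "abs_continuous_on {a..b} u"
  shows "continuous_on {a..b} u"
  unfolding continuous_on_iff
proof (intro ballI allI impI)
  fix x \<epsilon> :: real assume x: "x \<in> {a..b}" and "\<epsilon> > 0"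
  then obtain \<delta> where "\<delta> > 0" and \<delta>: "\<And>F. \<lbrakk>finite F; \<And>c d. (c, d) \<in> F \<Longrightarrow> c \<le> d \<and> {c..d} \<subseteq> {a..b};
       disjoint_family_on (\<lambda>(c, d). {c<..<d}) F; (\<Sum>(c, d)\<in>F. d - c) < \<delta>\<rbrakk>
       \<Longrightarrow> (\<Sum>(c, d)\<in>F. \<bar>u d - u c\<bar>) < \<epsilon>"
    using abs_continuous_onD [OF assms] by metis
  have "dist (u y) (u x) < \<epsilon>" if "y \<in> {a..b}" "dist y x < \<delta>" for y
  proof -
    \<comment> \<open>A family of one interval suffices; \<open>min\<close> and \<open>max\<close>
      allow \<open>y\<close> on either side of \<open>x\<close>.\<close>
    have "(\<Sum>(c, d)\<in>{(min x y, max x y)}. \<bar>u d - u c\<bar>) < \<epsilon>"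
      by (rule \<delta>) (use that x in \<open>auto simp: disjoint_family_on_def dist_real_def min_def max_def\<close>)
    then show ?thesis
      by (cases "x \<le> y") (auto simp: dist_real_def min_def max_def)
  qed
  then show "\<exists>\<delta>>0. \<forall>y\<in>{a..b}. dist y x < \<delta> \<longrightarrow> dist (u y) (u x) < \<epsilon>"
    using \<open>\<delta> > 0\<close> by blast
qed

section \<open>Differentiation of indefinite integrals\<close>

text \<open>
  For fixed \<open>\<eta>\<close>, the points \<open>x\<close> having arbitrarily small intervals with endpoint \<open>x\<close> on which the difference
  quotient is off by more than \<open>\<eta>\<close> are Vitali-covered by these intervals. Finitely many disjoint
  ones, tagged at the bad points, form a partial division to which Henstock's lemma applies and bounds their total length.
\<close>
lemma negligible_integral_not_has_real_derivative:
  fixes \<phi> :: "real \<Rightarrow> real"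
  assumes int: "\<phi> integrable_on {a..b}"
  shows "negligible {x \<in> {a..b}. \<not> ((\<lambda>t. integral {a..t} \<phi>) has_real_derivative \<phi> x) (at x within {a..b})}"
proof -
  define \<Phi> where "\<Phi> t = integral {a..t} \<phi>" for t
  define B where "B \<eta> = {x \<in> {a..b}. \<forall>\<delta>>0. \<exists>y\<in>{a..b}. 0 < \<bar>y - x\<bar> \<and> \<bar>y - x\<bar> < \<delta> \<and>
      \<eta> * \<bar>y - x\<bar> < \<bar>\<Phi> y - \<Phi> x - \<phi> x * (y - x)\<bar>}" for \<eta>
  \<comment> \<open>Henstock's error for the interval between \<open>x\<close> and \<open>y\<close>,
    tagged at \<open>x\<close>, is the error of linearising \<open>\<Phi>\<close> at
    \<open>x\<close>. If \<open>y\<close> lies to the left of \<open>x\<close>, both signs flip and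
    the absolute value hides it.\<close>
  have increment: "\<bar>measure lborel {min x y..max x y} * \<phi> x - integral {min x y..max x y} \<phi>\<bar> =
      \<bar>\<Phi> y - \<Phi> x - \<phi> x * (y - x)\<bar>" if "x \<in> {a..b}" "y \<in> {a..b}" for x y
  proof -
    have *: "\<Phi> c + integral {c..d} \<phi> = \<Phi> d" if "a \<le> c" "c \<le> d" "d \<le> b" for c d
      unfolding \<Phi>_def using that int
      by (intro Henstock_Kurzweil_Integration.integral_combine) (auto intro: integrable_subinterval_real)
    show ?thesis
    proof (cases "x \<le> y")
      case True
      then show ?thesis using * [of x y] that by (simp add: algebra_simps abs_if)
    next
      case False
      then show ?thesis using * [of y x] that by (simp add: algebra_simps abs_if min_def max_def)
    qed
  qed
  have B: "negligible (B \<eta>)" if "\<eta> > 0" for \<eta>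
    unfolding negligible_outer_le
  proof (intro allI impI)
    \<comment> \<open>Each bad interval has error above \<open>\<eta>\<close> times its length, so a
      total error below \<open>e * \<eta>\<close> leaves a total length of at most
      \<open>e\<close>.\<close>
    fix e :: real assume "e > 0"
    then obtain \<gamma> where "gauge \<gamma>" and \<gamma>: "\<And>p. \<lbrakk>p tagged_partial_division_of {a..b}; \<gamma> fine p\<rbrakk> \<Longrightarrow>
         (\<Sum>(x,K)\<in>p. norm (measure lborel K *\<^sub>R \<phi> x - integral K \<phi>)) < e * \<eta>"
      using Henstock_lemma [of \<phi> a b "e * \<eta>"] int \<open>\<eta> > 0\<close> by auto
    \<comment> \<open>An index is a tag together with the opposite endpoint. The tag thus survives
      although the covering theorem sees only balls, with centre \<open>m\<close> and radius
      \<open>r\<close>; inclusion in \<open>\<gamma> x\<close> will give fineness.\<close>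
    define K where "K = {(x, y). x \<in> {a..b} \<and> y \<in> {a..b} \<and> x \<noteq> y \<and> {min x y..max x y} \<subseteq> \<gamma> x \<and>
        \<eta> * \<bar>y - x\<bar> < \<bar>\<Phi> y - \<Phi> x - \<phi> x * (y - x)\<bar>}"
    define m where "m = (\<lambda>(x, y). (x + y) / 2 :: real)"
    define r where "r = (\<lambda>(x, y). \<bar>y - x\<bar> / 2 :: real)"
    have ball: "cball (m (x, y)) (r (x, y)) = {min x y..max x y}" for x y
      by (auto simp: m_def r_def cball_eq_atLeastAtMost min_def max_def field_simps abs_if)
    obtain C where C: "countable C" "C \<subseteq> K"
      and disj: "pairwise (\<lambda>i j. disjnt (cball (m i) (r i)) (cball (m j) (r j))) C"
      and rest: "negligible (B \<eta> - (\<Union>i\<in>C. cball (m i) (r i)))"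
    proof (rule Vitali_covering_theorem_cballs [of K r "B \<eta>" m])
      show "0 < r i" if "i \<in> K" for i
        using that by (auto simp: K_def r_def)
    next
      fix x d :: real assume x: "x \<in> B \<eta>" and "0 < d"
      obtain \<rho> where "\<rho> > 0" and \<rho>: "ball x \<rho> \<subseteq> \<gamma> x"
        using \<open>gauge \<gamma>\<close> unfolding gauge_def by (meson openE)
      have "min d \<rho> > 0" using \<open>\<rho> > 0\<close> \<open>0 < d\<close> by simp
      then obtain y where y: "y \<in> {a..b}" "0 < \<bar>y - x\<bar>" "\<bar>y - x\<bar> < min d \<rho>"
          "\<eta> * \<bar>y - x\<bar> < \<bar>\<Phi> y - \<Phi> x - \<phi> x * (y - x)\<bar>"
        using x unfolding B_def by blast
      have "{min x y..max x y} \<subseteq> ball x \<rho>"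
        using y by (auto simp: dist_real_def)
      with \<rho> x y have "(x, y) \<in> K"
        by (auto simp: K_def B_def)
      moreover have "x \<in> cball (m (x, y)) (r (x, y))"
        unfolding ball by simp
      moreover have "r (x, y) < d"
        using y(2,3) by (auto simp: r_def)
      ultimately show "\<exists>i. i \<in> K \<and> x \<in> cball (m i) (r i) \<and> r i < d"
        by blast
    qed
    \<comment> \<open>The Vitali family is countable while Henstock's lemma takes finite divisions;
      a bound uniform in the finite subfamily \<open>D\<close> passes to the whole union.\<close>
    have bound: "measure lebesgue (\<Union>i\<in>D. cball (m i) (r i)) \<le> e" if D: "D \<subseteq> C" "finite D" for D
    proof -
      define \<tau> where "\<tau> = (\<lambda>(x, y). (x :: real, {min x y..max x y :: real}))"
      have disjD: "cball (m i) (r i) \<inter> cball (m j) (r j) = {}" if "i \<in> D" "j \<in> D" "i \<noteq> j" for i j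
        using disj D that unfolding pairwise_def disjnt_def by blast
      have inj: "inj_on \<tau> D"
      proof (rule inj_onI)
        fix i j assume ij: "i \<in> D" "j \<in> D" "\<tau> i = \<tau> j"
        have "cball (m i) (r i) = cball (m j) (r j)" "cball (m i) (r i) \<noteq> {}"
          using ij by (cases i; cases j; auto simp: \<tau>_def ball)+
        with disjD ij show "i = j" by blast
      qed
      have "\<tau> ` D tagged_partial_division_of {a..b}"
        unfolding tagged_partial_division_of_def
      proof (intro conjI allI impI)
        show "finite (\<tau> ` D)" using D by simp
      next
        fix x L assume "(x, L) \<in> \<tau> ` D"
        then obtain y where y: "(x, y) \<in> D" "L = {min x y..max x y}"
          by (auto simp: \<tau>_def)
        then have "(x, y) \<in> K" using D C by blast
        then show "x \<in> L" "L \<subseteq> {a..b}" "\<exists>a b. L = cbox a b"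
          using y by (auto simp: K_def cbox_interval)
      next
        fix x L x' L' assume "(x, L) \<in> \<tau> ` D \<and> (x', L') \<in> \<tau> ` D \<and> (x, L) \<noteq> (x', L')"
        then obtain y y' where y: "(x, y) \<in> D" "L = {min x y..max x y}" 
            "(x', y') \<in> D" "L' = {min x' y'..max x' y'}" "(x, y) \<noteq> (x', y')"
          by (auto simp: \<tau>_def)
        then have "L \<inter> L' = {}"
          using disjD [of "(x, y)" "(x', y')"] by (simp add: ball)
        then show "interior L \<inter> interior L' = {}"
          using interior_subset by blast
      qed
      moreover have "\<gamma> fine \<tau> ` D"
        using D C by (fastforce simp: fine_def \<tau>_def K_def)
      ultimately have less: "(\<Sum>(x,K)\<in>\<tau> ` D. norm (measure lborel K *\<^sub>R \<phi> x - integral K \<phi>)) < e * \<eta>"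
        by (rule \<gamma>)
      have "\<eta> * measure lebesgue (\<Union>i\<in>D. cball (m i) (r i)) \<le> \<eta> * (\<Sum>i\<in>D. measure lebesgue (cball (m i) (r i)))"
        using D \<open>\<eta> > 0\<close> by (intro mult_left_mono measure_UNION_le) auto
      also have "\<dots> = (\<Sum>(x,y)\<in>D. \<eta> * \<bar>y - x\<bar>)"
        by (auto simp: sum_distrib_left ball min_def max_def intro!: sum.cong)
      also have "\<dots> \<le> (\<Sum>(x,y)\<in>D. \<bar>\<Phi> y - \<Phi> x - \<phi> x * (y - x)\<bar>)"
        using D C by (intro sum_mono) (auto simp: K_def less_imp_le)
      also have "\<dots> = (\<Sum>(x,y)\<in>D. norm (measure lborel {min x y..max x y} *\<^sub>R \<phi> x - integral {min x y..max x y} \<phi>))"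
      proof (intro sum.cong refl, clarify)
        fix x y assume "(x, y) \<in> D"
        then have "x \<in> {a..b}" "y \<in> {a..b}"
          using D C by (auto simp: K_def)
        then show "\<bar>\<Phi> y - \<Phi> x - \<phi> x * (y - x)\<bar> =
            norm (measure lborel {min x y..max x y} *\<^sub>R \<phi> x - integral {min x y..max x y} \<phi>)"
          by (simp only: increment real_norm_def real_scaleR_def)
      qed
      also have "\<dots> = (\<Sum>(x,K)\<in>\<tau> ` D. norm (measure lborel K *\<^sub>R \<phi> x - integral K \<phi>))"
        using inj by (subst sum.reindex) (auto simp: \<tau>_def split_def o_def)
      also note less
      finally show ?thesis
        using \<open>\<eta> > 0\<close> by (simp add: mult.commute)
    qed
    have U: "(\<Union>i\<in>C. cball (m i) (r i)) \<in> lmeasurable" "measure lebesgue (\<Union>i\<in>C. cball (m i) (r i)) \<le> e"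
      using fmeasurable_UN_bound [OF C(1) _ bound] measure_UN_bound [OF C(1) _ bound] by auto
    \<comment> \<open>The balls together with the null remainder left by the covering
      theorem.\<close>
    let ?T = "(\<Union>i\<in>C. cball (m i) (r i)) \<union> (B \<eta> - (\<Union>i\<in>C. cball (m i) (r i)))"
    have "B \<eta> \<subseteq> ?T" by blast
    moreover have "?T \<in> lmeasurable"
      using U(1) negligible_imp_measurable [OF rest] by (rule fmeasurable.Un)
    moreover have "measure lebesgue ?T \<le> e"
      using measure_Un_null_set [OF fmeasurableD [OF U(1)]] U(2) rest
      by (simp only: negligible_iff_null_sets)
    ultimately show "\<exists>T. B \<eta> \<subseteq> T \<and> T \<in> lmeasurable \<and> measure lebesgue T \<le> e"
      by blast
  qed
  \<comment> \<open>A point outside every \<open>B (1 / Suc n)\<close> has, for each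
    \<open>n\<close>, a linearisation error of at most \<open>1 / Suc n\<close> times the distance
    nearby, which is differentiability. Countably many thresholds keep the union negligible.\<close>
  have "{x \<in> {a..b}. \<not> (\<Phi> has_real_derivative \<phi> x) (at x within {a..b})} \<subseteq> (\<Union>n. B (1 / Suc n))"
  proof
    fix x assume x: "x \<in> {x \<in> {a..b}. \<not> (\<Phi> has_real_derivative \<phi> x) (at x within {a..b})}"
    show "x \<in> (\<Union>n. B (1 / Suc n))"
    proof (rule ccontr)
      assume "x \<notin> (\<Union>n. B (1 / Suc n))"
      then have *: "\<exists>\<delta>>0. \<forall>y\<in>{a..b}. 0 < \<bar>y - x\<bar> \<longrightarrow> \<bar>y - x\<bar> < \<delta> \<longrightarrow>
            \<bar>\<Phi> y - \<Phi> x - \<phi> x * (y - x)\<bar> \<le> 1 / Suc n * \<bar>y - x\<bar>" for n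
      proof -
        have "x \<notin> B (1 / Suc n)"
          using \<open>x \<notin> (\<Union>n. B (1 / Suc n))\<close> by blast
        then obtain \<delta> where "\<delta> > 0" and \<delta>: "\<not> (\<exists>y\<in>{a..b}. 0 < \<bar>y - x\<bar> \<and> \<bar>y - x\<bar> < \<delta> \<and>
            1 / Suc n * \<bar>y - x\<bar> < \<bar>\<Phi> y - \<Phi> x - \<phi> x * (y - x)\<bar>)"
          using x unfolding B_def by blast
        show ?thesis
          using \<delta> by (intro exI [of _ \<delta>] conjI \<open>\<delta> > 0\<close> ballI impI leI) blast
      qed
      have "(\<Phi> has_derivative (*) (\<phi> x)) (at x within {a..b})"
        unfolding has_derivative_within_alt
      proof (intro conjI allI impI bounded_linear_mult_right)
        fix \<epsilon> :: real assume "\<epsilon> > 0"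
        then obtain n where n: "1 / Suc n < \<epsilon>"
          using nat_approx_posE by blast
        obtain \<delta> where "\<delta> > 0" and \<delta>: "\<And>y. \<lbrakk>y \<in> {a..b}; 0 < \<bar>y - x\<bar>; \<bar>y - x\<bar> < \<delta>\<rbrakk> \<Longrightarrow>
            \<bar>\<Phi> y - \<Phi> x - \<phi> x * (y - x)\<bar> \<le> 1 / Suc n * \<bar>y - x\<bar>"
          using * [of n] by blast
        have "norm (\<Phi> y - \<Phi> x - \<phi> x * (y - x)) \<le> \<epsilon> * norm (y - x)"
          if "y \<in> {a..b}" "norm (y - x) < \<delta>" for y
        proof (cases "y = x")
          case False
          then have "\<bar>\<Phi> y - \<Phi> x - \<phi> x * (y - x)\<bar> \<le> 1 / Suc n * \<bar>y - x\<bar>"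
            using that by (intro \<delta>) auto
          also have "\<dots> \<le> \<epsilon> * \<bar>y - x\<bar>"
            using n by (intro mult_right_mono) auto
          finally show ?thesis by simp
        qed simp
        then show "\<exists>\<delta>>0. \<forall>y\<in>{a..b}. norm (y - x) < \<delta> \<longrightarrow>
            norm (\<Phi> y - \<Phi> x - \<phi> x * (y - x)) \<le> \<epsilon> * norm (y - x)"
          using \<open>\<delta> > 0\<close> by blast
      qed
      with x show False
        by (simp add: has_field_derivative_def)
    qed
  qed
  moreover have "negligible (\<Union>n. B (1 / Suc n))"
    using B by (intro negligible_countable_Union) auto
  ultimately show ?thesis
    unfolding \<Phi>_def using negligible_subset by blast
qed

section \<open>Monotonicity from the sign of the derivative\<close>

text \<open>
  Take a tagged division in which the cells tagged in \<open>N\<close> lie in an open set of small measure, so that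
  absolute continuity bounds their increments, while all other cells have slope at most \<open>e\<close>.
\<close>
lemma abs_continuous_on_nonincreasing:
  assumes ac: "abs_continuous_on {a..b} u" and "a \<le> b" and N: "negligible N"
    and deriv: "\<And>t. t \<in> {a..b} - N \<Longrightarrow> \<exists>D\<le>0. (u has_real_derivative D) (at t within {a..b})"
  shows "u b \<le> u a"
proof (rule field_le_epsilon)
  fix e' :: real assume "e' > 0"
  \<comment> \<open>The budget is \<open>e\<close> for the cells tagged in \<open>N\<close> plus
    slope \<open>e\<close> over the length \<open>b - a\<close>; the summand 1 also keeps the
    denominator positive when \<open>a = b\<close>.\<close>
  define e where "e = e' / (1 + (b - a))"
  have e: "e > 0"
    using \<open>e' > 0\<close> \<open>a \<le> b\<close> by (simp add: e_def)
  have "e * (1 + (b - a)) = e'"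
    using \<open>a \<le> b\<close> by (simp add: e_def)
  then have e': "e + e * (b - a) = e'"
    by (simp only: distrib_left mult_1_right)
  obtain \<delta> where "\<delta> > 0" and \<delta>: "\<And>F. \<lbrakk>finite F; \<And>c d. (c, d) \<in> F \<Longrightarrow> c \<le> d \<and> {c..d} \<subseteq> {a..b};
       disjoint_family_on (\<lambda>(c, d). {c<..<d}) F; (\<Sum>(c, d)\<in>F. d - c) < \<delta>\<rbrakk>
       \<Longrightarrow> (\<Sum>(c, d)\<in>F. \<bar>u d - u c\<bar>) < e"
    using abs_continuous_onD [OF ac e] by metis
  obtain U where U: "open U" "N \<subseteq> U" "U \<in> lmeasurable" "measure lebesgue U < \<delta>"
    using negligible_outer_open [OF N \<open>\<delta> > 0\<close>] .
  \<comment> \<open>Cells contain their tag, so the increment splits at \<open>x\<close>. With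
    \<open>D \<le> 0\<close> the linear term helps on both sides, and the two errors add up to
    \<open>e * (d - c)\<close>. A radius is provided for every \<open>x\<close>, with dummy value 1
    where nothing is claimed, so that it can be chosen as a function.\<close>
  have "\<exists>r>0. x \<in> {a..b} - N \<longrightarrow> (\<forall>c\<in>{a..b}. \<forall>d\<in>{a..b}. c \<le> x \<longrightarrow> x \<le> d \<longrightarrow>
      {c..d} \<subseteq> ball x r \<longrightarrow> u d - u c \<le> e * (d - c))" for x
  proof (cases "x \<in> {a..b} - N")
    case True
    then obtain D where "D \<le> 0" and "(u has_real_derivative D) (at x within {a..b})"
      using deriv by blast
    then obtain r where "r > 0"
      and r: "\<And>y. \<lbrakk>y \<in> {a..b}; \<bar>y - x\<bar> < r\<rbrakk> \<Longrightarrow> \<bar>u y - u x - D * (y - x)\<bar> \<le> e * \<bar>y - x\<bar>"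
      using \<open>e > 0\<close> unfolding has_field_derivative_def has_derivative_within_alt by auto
    have "u d - u c \<le> e * (d - c)"
      if cd: "c \<in> {a..b}" "d \<in> {a..b}" "c \<le> x" "x \<le> d" "{c..d} \<subseteq> ball x r" for c d
    proof -
      have "c \<in> {c..d}" "d \<in> {c..d}"
        using cd by auto
      then have "c \<in> ball x r" "d \<in> ball x r"
        using cd by blast+
      then have "\<bar>u c - u x - D * (c - x)\<bar> \<le> e * (x - c)" "\<bar>u d - u x - D * (d - x)\<bar> \<le> e * (d - x)"
        using r [of c] r [of d] cd by (auto simp: dist_real_def)
      moreover have "D * (c - x) \<ge> 0" "D * (d - x) \<le> 0"
        using \<open>D \<le> 0\<close> cd by (auto intro: mult_nonpos_nonpos mult_nonpos_nonneg)
      ultimately show ?thesis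
        by (simp add: algebra_simps)
    qed
    with \<open>r > 0\<close> show ?thesis by blast
  next
    case False
    then show ?thesis by (intro exI [of _ 1]) auto
  qed
  then obtain r where r: "\<And>x. r x > 0"
    and slope: "\<And>x c d. \<lbrakk>x \<in> {a..b} - N; c \<in> {a..b}; d \<in> {a..b}; c \<le> x; x \<le> d; {c..d} \<subseteq> ball x (r x)\<rbrakk>
        \<Longrightarrow> u d - u c \<le> e * (d - c)"
    by metis
  define \<gamma> where "\<gamma> x = (if x \<in> N then U else ball x (r x))" for x
  have "gauge \<gamma>"
    using U r by (auto simp: gauge_def \<gamma>_def)
  then obtain p where p: "p tagged_division_of {a..b}" "\<gamma> fine p"
    using fine_division_exists_real by blast
  note pD = tagged_division_ofD [OF p(1)]
  have cell: "\<exists>c d. K = {c..d} \<and> c \<le> x \<and> x \<le> d \<and> c \<in> {a..b} \<and> d \<in> {a..b}"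
    if xK: "(x, K) \<in> p" for x K
  proof -
    obtain c d where "K = cbox c d" using pD(4) [OF xK] by blast
    with pD(2,3) [OF xK] show ?thesis
      by (intro exI [of _ c] exI [of _ d]) auto
  qed
  define q where "q = {z \<in> p. fst z \<in> N}"
  have q: "q \<subseteq> p" "finite q" "finite p"
    using pD(1) by (auto simp: q_def)
  define \<pi> where "\<pi> = (\<lambda>(x :: real, K :: real set). (Inf K, Sup K))"
  \<comment> \<open>Several tagged pairs may share one degenerate interval, so \<open>\<pi>\<close> need not be injective on \<open>q\<close>.\<close>
  have reindex: "(\<Sum>(c, d)\<in>\<pi> ` q. g c d) = (\<Sum>(x, K)\<in>q. g (Inf K) (Sup K))" 
    if "\<And>c. g c c = 0" for g :: "real \<Rightarrow> real \<Rightarrow> real"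
  proof -
    have "(\<Sum>(c, d)\<in>\<pi> ` q. g c d) = sum ((\<lambda>(c, d). g c d) \<circ> \<pi>) q"
    proof (rule sum.reindex_nontrivial [OF q(2)])
      fix z z' assume z: "z \<in> q" "z' \<in> q" "z \<noteq> z'" "\<pi> z = \<pi> z'"
      obtain x K x' K' where zK: "z = (x, K)" "z' = (x', K')"
        by (cases z, cases z')
      then have xK: "(x, K) \<in> p" "(x', K') \<in> p"
        using z q by auto
      obtain c d where cd: "K = {c..d}" "c \<le> d"
        using cell [OF xK(1)] by auto
      obtain c' d' where cd': "K' = {c'..d'}" "c' \<le> d'"
        using cell [OF xK(2)] by auto
      have "K = K'"
        using z(4) cd cd' by (simp add: zK \<pi>_def)
      then have "interior K = {}"
        using pD(5) [OF xK] z(3) by (simp add: zK)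
      then have "c = d"
        using cd by auto
      then show "(case \<pi> z of (c, d) \<Rightarrow> g c d) = 0"
        using cd that by (simp add: zK \<pi>_def)
    qed
    also have "\<dots> = (\<Sum>(x, K)\<in>q. g (Inf K) (Sup K))"
      by (simp add: \<pi>_def split_def o_def)
    finally show ?thesis .
  qed
  have "(\<Sum>(c, d)\<in>\<pi> ` q. \<bar>u d - u c\<bar>) < e"
  proof (rule \<delta>)
    show "finite (\<pi> ` q)" using q by simp
    show "c \<le> d \<and> {c..d} \<subseteq> {a..b}" if cd: "(c, d) \<in> \<pi> ` q" for c d
    proof -
      obtain x K where "(x, K) \<in> p" "c = Inf K" "d = Sup K"
        using cd q by (auto simp: \<pi>_def)
      with cell [of x K] show ?thesis by auto
    qed
    show "disjoint_family_on (\<lambda>(c, d). {c<..<d}) (\<pi> ` q)"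
      unfolding disjoint_family_on_def
    proof (intro ballI impI)
      fix y y' assume y: "y \<in> \<pi> ` q" "y' \<in> \<pi> ` q" "y \<noteq> y'"
      obtain x K where K: "(x, K) \<in> p" "y = (Inf K, Sup K)"
        using y(1) q(1) by (auto simp: \<pi>_def)
      obtain x' K' where K': "(x', K') \<in> p" "y' = (Inf K', Sup K')"
        using y(2) q(1) by (auto simp: \<pi>_def)
      obtain c d where cd: "K = {c..d}" "c \<le> d"
        using cell [OF K(1)] by auto
      obtain c' d' where cd': "K' = {c'..d'}" "c' \<le> d'"
        using cell [OF K'(1)] by auto
      have "interior K \<inter> interior K' = {}"
        using pD(5) [OF K(1) K'(1)] y(3) K(2) K'(2) by auto
      then show "(case y of (c, d) \<Rightarrow> {c<..<d}) \<inter> (case y' of (c, d) \<Rightarrow> {c<..<d}) = {}"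
        using cd cd' K(2) K'(2) by simp
    qed
    have part: "q tagged_partial_division_of {a..b}"
      using p(1) by (intro tagged_partial_division_subset [OF _ q(1)]) (simp add: tagged_division_of_def)
    have D: "snd ` q division_of \<Union>(snd ` q)"
      by (rule partial_division_of_tagged_division [OF part])
    have "(\<Sum>(c, d)\<in>\<pi> ` q. d - c) = (\<Sum>(x, K)\<in>q. Sup K - Inf K)"
      by (rule reindex) simp
    also have "\<dots> = (\<Sum>(x, K)\<in>q. measure lborel K)"
    proof (intro sum.cong refl, clarify)
      fix x K assume "(x, K) \<in> q"
      then have "(x, K) \<in> p" using q by blast
      then obtain c d where "K = {c..d}" "c \<le> d"
        using cell [of x K] by auto
      then show "Sup K - Inf K = measure lborel K" by simp
    qed
    \<comment> \<open>Forgetting the tags merges pairs sharing a cell; such a cell has empty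
      interior, hence length 0, so the sum is unchanged.\<close>
    also have "\<dots> = (\<Sum>K\<in>snd ` q. measure lborel K)"
      by (rule sum.over_tagged_division_lemma [OF tagged_partial_division_of_Union_self [OF part]])
         (rule content_eq_0_interior [THEN iffD2], simp add: interior_cbox)
    also have "\<dots> = (\<Sum>K\<in>snd ` q. measure lebesgue K)"
    proof (rule sum.cong [OF refl])
      fix K assume "K \<in> snd ` q"
      then obtain c d where "K = cbox c d"
        using division_ofD(4) [OF D] by blast
      then show "measure lborel K = measure lebesgue K" by simp
    qed
    also have "\<dots> = measure lebesgue (\<Union>(snd ` q))"
      using content_division [OF D] by simp
    also have "\<dots> \<le> measure lebesgue U"
    proof (rule measure_mono_fmeasurable [OF _ _ U(3)])
      show "\<Union>(snd ` q) \<subseteq> U"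
        using p(2) by (force simp: fine_def q_def \<gamma>_def)
      show "\<Union>(snd ` q) \<in> sets lebesgue"
        using D lmeasurable_division by blast
    qed
    also have "\<dots> < \<delta>" by (rule U(4))
    finally show "(\<Sum>(c, d)\<in>\<pi> ` q. d - c) < \<delta>" .
  qed
  then have bad: "(\<Sum>(x, K)\<in>q. \<bar>u (Sup K) - u (Inf K)\<bar>) < e"
    by (subst (asm) reindex) auto
  have len: "(\<Sum>(x, K)\<in>p. Sup K - Inf K) = b - a"
    using additive_tagged_division_1 [OF \<open>a \<le> b\<close> p(1), of "\<lambda>x. x"] by simp
  have "u b - u a = (\<Sum>(x, K)\<in>p. u (Sup K) - u (Inf K))"
    using additive_tagged_division_1 [OF \<open>a \<le> b\<close> p(1), of u] by simp
  also have "\<dots> = (\<Sum>(x, K)\<in>q. u (Sup K) - u (Inf K)) + (\<Sum>(x, K)\<in>p - q. u (Sup K) - u (Inf K))"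
    using q by (subst sum.subset_diff [of q p]) auto
  also have "(\<Sum>(x, K)\<in>q. u (Sup K) - u (Inf K)) \<le> (\<Sum>(x, K)\<in>q. \<bar>u (Sup K) - u (Inf K)\<bar>)"
    by (intro sum_mono) auto
  also note bad
  also have "(\<Sum>(x, K)\<in>p - q. u (Sup K) - u (Inf K)) \<le> (\<Sum>(x, K)\<in>p - q. e * (Sup K - Inf K))"
  proof (rule sum_mono, clarify)
    fix x K assume xK: "(x, K) \<in> p" "(x, K) \<notin> q"
    obtain c d where cd: "K = {c..d}" "c \<le> x" "x \<le> d" "c \<in> {a..b}" "d \<in> {a..b}"
      using cell [OF xK(1)] by blast
    have "x \<notin> N" using xK by (auto simp: q_def)
    moreover from this have "K \<subseteq> ball x (r x)"
      using p(2) xK(1) by (force simp: fine_def \<gamma>_def)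
    ultimately have "u d - u c \<le> e * (d - c)"
      using cd by (intro slope [of x]) auto
    then show "u (Sup K) - u (Inf K) \<le> e * (Sup K - Inf K)"
      using cd by simp
  qed
  \<comment> \<open>Putting the cells of \<open>q\<close> back adds only nonnegative terms and lets
    the lengths sum to \<open>b - a\<close>.\<close>
  also have "\<dots> \<le> (\<Sum>(x, K)\<in>p. e * (Sup K - Inf K))"
  proof (rule sum_mono2 [OF q(3)])
    fix z assume "z \<in> p - (p - q)"
    then obtain x K where "z = (x, K)" "(x, K) \<in> p" using q by (cases z) auto
    with cell [of x K] e show "0 \<le> (case z of (x, K) \<Rightarrow> e * (Sup K - Inf K))" by auto
  qed auto
  also have "\<dots> = e * (b - a)"
    by (simp add: len [symmetric] sum_distrib_left split_def)
  finally have "u b - u a < e + e * (b - a)" by simp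
  then show "u b \<le> u a + e'"
    using e' by simp
qed

section \<open>Differences and products of absolutely continuous functions\<close>

lemma abs_continuous_on_diff:
  assumes "abs_continuous_on S u" "abs_continuous_on S v"
  shows "abs_continuous_on S (\<lambda>x. u x - v x)"
  by (rule abs_continuous_on_dominated [OF assms, where M = 1]) auto

lemma abs_continuous_on_mult:
  assumes u: "abs_continuous_on {a..b} u" and v: "abs_continuous_on {a..b} v"
  shows "abs_continuous_on {a..b} (\<lambda>x. u x * v x)"
proof -
  have "bounded (u ` {a..b})" "bounded (v ` {a..b})"
    using assms by (auto intro!: compact_imp_bounded compact_continuous_image abs_continuous_on_imp_continuous_on)
  then obtain P Q where P: "\<forall>x\<in>{a..b}. \<bar>u x\<bar> \<le> P" and Q: "\<forall>x\<in>{a..b}. \<bar>v x\<bar> \<le> Q"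
    unfolding bounded_iff by auto
  show ?thesis
  proof (rule abs_continuous_on_dominated [OF u v])
    fix c d assume cd: "c \<in> {a..b}" "d \<in> {a..b}"
    have "u d * v d - u c * v c = v d * (u d - u c) + u c * (v d - v c)"
      by (simp add: algebra_simps)
    also have "\<bar>\<dots>\<bar> \<le> \<bar>v d\<bar> * \<bar>u d - u c\<bar> + \<bar>u c\<bar> * \<bar>v d - v c\<bar>"
      by (metis abs_mult abs_triangle_ineq)
    also have "\<dots> \<le> max P Q * \<bar>u d - u c\<bar> + max P Q * \<bar>v d - v c\<bar>"
      using bspec [OF P cd(1)] bspec [OF Q cd(2)] by (intro add_mono mult_right_mono) auto
    finally show "\<bar>u d * v d - u c * v c\<bar> \<le> max P Q * (\<bar>u d - u c\<bar> + \<bar>v d - v c\<bar>)"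
      by (simp add: distrib_left)
  qed
qed

section \<open>The periodic problem\<close>

lemma periodic_solution_unique:
  assumes "T > 0" "c > 0"
    and diss: "\<And>t s1 s2. \<lbrakk>t \<in> {0..T}; s1 \<le> s2\<rbrakk> \<Longrightarrow> f t s2 - f t s1 \<le> - c * (s2 - s1)"
    and u: "periodic_solution T f u" and v: "periodic_solution T f v" and "t \<in> {0..T}"
  shows "u t = v t"
proof -
  \<comment> \<open>The square is differentiable wherever both solutions are, and it treats the two
    orders of \<open>u t\<close> and \<open>v t\<close> alike.\<close>
  define V where "V t = (u t - v t) * (u t - v t)" for t
  define N where "N = {t \<in> {0..T}. \<not> (u has_real_derivative f t (u t)) (at t within {0..T})} \<union>
                      {t \<in> {0..T}. \<not> (v has_real_derivative f t (v t)) (at t within {0..T})}"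
  have N: "negligible N"
    using u v by (auto simp: N_def periodic_solution_def AE_lebesgue_on_iff_negligible)
  have acV: "abs_continuous_on {0..T} V"
    unfolding V_def using u v
    by (intro abs_continuous_on_mult abs_continuous_on_diff) (auto simp: periodic_solution_def)
  have deriv: "\<exists>D\<le>- 2 * c * V t. (V has_real_derivative D) (at t within {0..T})" if "t \<in> {0..T} - N" for t
  proof (intro exI conjI)
    have *: "(u has_real_derivative f t (u t)) (at t within {0..T})" 
        "(v has_real_derivative f t (v t)) (at t within {0..T})"
      using that by (auto simp: N_def)
    show "(V has_real_derivative 2 * ((u t - v t) * (f t (u t) - f t (v t)))) (at t within {0..T})"
      unfolding V_def by (rule derivative_eq_intros * refl)+ (simp add: algebra_simps)
    \<comment> \<open>The product is symmetric in the two solutions, so the one-sided estimate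
      \<open>diss\<close> applies with the smaller value first.\<close>
    have "(u t - v t) * (f t (u t) - f t (v t)) \<le> - c * V t"
    proof (cases "v t \<le> u t")
      case True
      then have "(u t - v t) * (f t (u t) - f t (v t)) \<le> (u t - v t) * (- c * (u t - v t))"
        using that by (intro mult_left_mono diss) auto
      then show ?thesis by (simp add: V_def algebra_simps)
    next
      case False
      then have "(v t - u t) * (f t (v t) - f t (u t)) \<le> (v t - u t) * (- c * (v t - u t))"
        using that by (intro mult_left_mono diss) auto
      then show ?thesis by (simp add: V_def algebra_simps)
    qed
    then show "2 * ((u t - v t) * (f t (u t) - f t (v t))) \<le> - 2 * c * V t"
      by simp
  qed
  have Vpos: "V t \<ge> 0" for t
    by (simp add: V_def)
  have mono: "V y \<le> V x" if xy: "0 \<le> x" "x \<le> y" "y \<le> T" for x y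
  proof (rule abs_continuous_on_nonincreasing [OF _ \<open>x \<le> y\<close> N])
    show "abs_continuous_on {x..y} V"
      using that by (intro abs_continuous_on_subset [OF acV]) auto
    fix t assume t: "t \<in> {x..y} - N"
    then obtain D where D: "D \<le> - 2 * c * V t" "(V has_real_derivative D) (at t within {0..T})"
      using deriv [of t] xy by auto
    have "D \<le> 0"
      using D(1) Vpos [of t] \<open>c > 0\<close> mult_nonneg_nonneg [of "2 * c" "V t"] by linarith
    moreover have "(V has_real_derivative D) (at t within {x..y})"
      using that by (intro DERIV_subset [OF D(2)]) auto
    ultimately show "\<exists>D\<le>0. (V has_real_derivative D) (at t within {x..y})"
      by blast
  qed
  have "V 0 = V T"
    using u v by (simp add: V_def periodic_solution_def)
  then have const: "V t = V 0" if "t \<in> {0..T}" for t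
    using mono [of 0 t] mono [of t T] that by auto
  \<comment> \<open>The differential inequality is available only off \<open>N\<close>. At such a
    point in the open interval the derivative is two-sided, hence 0 because \<open>V\<close> is
    locally constant, and the inequality then forces \<open>V\<close> to vanish there.\<close>
  have "\<not> negligible {0<..<T}"
    using \<open>T > 0\<close> negligible_interval(2) [of 0 T] by simp
  then have "\<not> {0<..<T} \<subseteq> N"
    using negligible_subset [OF N] by blast
  then obtain s where s: "0 < s" "s < T" "s \<notin> N"
    by (auto simp: subset_iff)
  then obtain D where D: "D \<le> - 2 * c * V s" "(V has_real_derivative D) (at s within {0..T})"
    using deriv [of s] by auto
  then have "DERIV V s :> D"
    using s by (simp add: at_within_Icc_at)
  then have "D = 0"
  proof (rule DERIV_local_const)
    show "0 < min s (T - s)" using s by simp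
    show "\<forall>y. \<bar>s - y\<bar> < min s (T - s) \<longrightarrow> V s = V y"
    proof (intro allI impI)
      fix y assume "\<bar>s - y\<bar> < min s (T - s)"
      then have "y \<in> {0..T}" by auto
      then show "V s = V y"
        using const [of s] const [of y] s by simp
    qed
  qed
  then have "c * V s \<le> 0"
    using D(1) by simp
  then have "V s = 0"
    using \<open>c > 0\<close> Vpos [of s] by (simp add: mult_le_0_iff)
  then have "V t = 0"
    using const [of s] const [of t] s \<open>t \<in> {0..T}\<close> by simp
  then show ?thesis
    by (simp add: V_def)
qed

section \<open>Measurability of superpositions\<close>

text \<open>Rounding \<open>u\<close> down to a grid gives functions with countably many values, for
  which the composition is pieced together from the measurable slices at fixed \<open>s\<close>.
  Continuity in \<open>s\<close> passes this to the limit as the grid is refined.\<close>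

lemma caratheodory_on_compose_measurable:
  assumes f: "caratheodory_on S f" and u: "u \<in> borel_measurable (lebesgue_on S)"
  shows "(\<lambda>t. f t (u t)) \<in> borel_measurable (lebesgue_on S)"
proof (rule borel_measurable_LIMSEQ_metric)
  define v where "v n t = real_of_int \<lfloor>real (Suc n) * u t\<rfloor> / real (Suc n)" for n t
  show "(\<lambda>t. f t (v n t)) \<in> borel_measurable (lebesgue_on S)" for n
    unfolding v_def
  proof (rule measurable_compose_countable [where f = "\<lambda>i t. f t (real_of_int i / real (Suc n))"])
    show "(\<lambda>t. f t (real_of_int i / real (Suc n))) \<in> borel_measurable (lebesgue_on S)" for i
      using f by (simp add: caratheodory_on_def)
    show "(\<lambda>t. \<lfloor>real (Suc n) * u t\<rfloor>) \<in> lebesgue_on S \<rightarrow>\<^sub>M count_space UNIV"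
      using u by measurable
  qed
  fix t assume "t \<in> space (lebesgue_on S)"
  then have "t \<in> S" by simp
  have "\<bar>v n t - u t\<bar> \<le> inverse (real (Suc n))" for n
  proof -
    have "real (Suc n) * (v n t - u t) = real_of_int \<lfloor>real (Suc n) * u t\<rfloor> - real (Suc n) * u t"
      by (simp add: v_def right_diff_distrib del: of_nat_Suc)
    then have "\<bar>real (Suc n) * (v n t - u t)\<bar> \<le> 1"
      by linarith
    then show ?thesis
      by (simp add: abs_mult inverse_eq_divide pos_le_divide_eq mult.commute del: of_nat_Suc)
  qed
  then have "(\<lambda>n. v n t - u t) \<longlonglongrightarrow> 0"
    by (intro Lim_null_comparison [OF _ LIMSEQ_inverse_real_of_nat]) auto
  then have "(\<lambda>n. v n t) \<longlonglongrightarrow> u t"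
    by (rule LIM_zero_cancel)
  moreover have "isCont (f t) (u t)"
    using f \<open>t \<in> S\<close> by (simp add: caratheodory_on_def continuous_on_eq_continuous_at)
  ultimately show "(\<lambda>n. f t (v n t)) \<longlonglongrightarrow> f t (u t)"
    by (rule isCont_tendsto_compose [rotated])
qed

section \<open>The linear periodic problem\<close>

text \<open>
  The \<open>T\<close>-periodic solution of \<open>v' + \<alpha> v = \<phi>\<close>, obtained by variation of constants; the first
  summand in the parentheses is the initial value forced by \<open>v 0 = v T\<close>.
\<close>
definition periodic_response :: "real \<Rightarrow> real \<Rightarrow> (real \<Rightarrow> real) \<Rightarrow> real \<Rightarrow> real" where
  "periodic_response \<alpha> T \<phi> t =
     exp (- \<alpha> * t) * (integral {0..T} (\<lambda>s. exp (\<alpha> * s) * \<phi> s) / (exp (\<alpha> * T) - 1) +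
                       integral {0..t} (\<lambda>s. exp (\<alpha> * s) * \<phi> s))"

lemma exp_weighted_integrable_on:
  fixes \<phi> :: "real \<Rightarrow> real"
  assumes "\<phi> \<in> borel_measurable (lebesgue_on {0..T})" "\<And>t. t \<in> {0..T} \<Longrightarrow> \<bar>\<phi> t\<bar> \<le> B"
  shows "(\<lambda>s. exp (\<alpha> * s) * \<phi> s) integrable_on {0..T}"
proof (rule measurable_bounded_by_integrable_imp_integrable_real)
  have "(\<lambda>s. exp (\<alpha> * s)) \<in> borel_measurable (lebesgue_on {0..T})"
    by (intro continuous_imp_measurable_on_sets_lebesgue continuous_intros) auto
  then show "(\<lambda>s. exp (\<alpha> * s) * \<phi> s) \<in> borel_measurable (lebesgue_on {0..T})"
    using assms(1) by (rule borel_measurable_times)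
  show "(\<lambda>s. exp (\<alpha> * s) * B) integrable_on {0..T}"
    by (intro integrable_continuous_interval continuous_intros)
  show "\<bar>exp (\<alpha> * s) * \<phi> s\<bar> \<le> exp (\<alpha> * s) * B" if "s \<in> {0..T}" for s
    using assms(2) [OF that] by (simp add: abs_mult)
qed auto

text \<open>The difference is compared with the exact integral of
  \<open>exp (\<alpha> * s) * c\<close>. The factor \<open>exp (\<alpha> * t) - 1\<close> is kept
  because it cancels exactly in the contraction estimate, both at \<open>t\<close> and at
  \<open>T\<close>.\<close>

lemma exp_weighted_integral_diff_le:
  fixes \<phi> \<psi> :: "real \<Rightarrow> real"
  assumes "\<alpha> > 0" "t \<in> {0..T}"
    and \<phi>: "(\<lambda>s. exp (\<alpha> * s) * \<phi> s) integrable_on {0..T}"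
    and \<psi>: "(\<lambda>s. exp (\<alpha> * s) * \<psi> s) integrable_on {0..T}"
    and c: "\<And>s. s \<in> {0..T} \<Longrightarrow> \<bar>\<phi> s - \<psi> s\<bar> \<le> c"
  shows "\<bar>integral {0..t} (\<lambda>s. exp (\<alpha> * s) * \<phi> s) - integral {0..t} (\<lambda>s. exp (\<alpha> * s) * \<psi> s)\<bar>
           \<le> c / \<alpha> * (exp (\<alpha> * t) - 1)"
proof -
  have int: "(\<lambda>s. exp (\<alpha> * s) * \<phi> s) integrable_on {0..t}" "(\<lambda>s. exp (\<alpha> * s) * \<psi> s) integrable_on {0..t}"
    using \<phi> \<psi> \<open>t \<in> {0..T}\<close> by (auto intro: integrable_subinterval_real)
  have "((\<lambda>s. exp (\<alpha> * s) * c) has_integral (c / \<alpha> * exp (\<alpha> * t) - c / \<alpha> * exp (\<alpha> * 0))) {0..t}"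
    using assms(1,2)
    by (intro fundamental_theorem_of_calculus)
       (auto simp flip: has_real_derivative_iff_has_vector_derivative intro!: derivative_eq_intros)
  then have I: "((\<lambda>s. exp (\<alpha> * s) * c) has_integral (c / \<alpha> * (exp (\<alpha> * t) - 1))) {0..t}"
    by (simp add: right_diff_distrib)
  have "\<bar>integral {0..t} (\<lambda>s. exp (\<alpha> * s) * \<phi> s - exp (\<alpha> * s) * \<psi> s)\<bar>
      \<le> integral {0..t} (\<lambda>s. exp (\<alpha> * s) * c)"
    unfolding real_norm_def [symmetric]
  proof (rule Henstock_Kurzweil_Integration.integral_norm_bound_integral)
    show "norm (exp (\<alpha> * s) * \<phi> s - exp (\<alpha> * s) * \<psi> s) \<le> exp (\<alpha> * s) * c" if "s \<in> {0..t}" for s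
      using c [of s] that assms(2) by (simp add: abs_mult flip: right_diff_distrib)
  qed (use int I in \<open>auto intro: integrable_diff has_integral_integrable\<close>)
  also have "\<dots> = c / \<alpha> * (exp (\<alpha> * t) - 1)"
    using I by (rule integral_unique)
  finally show ?thesis
    using int by (simp add: Henstock_Kurzweil_Integration.integral_diff)
qed

text \<open>The constant \<open>c / \<alpha>\<close> is the response to the constant forcing
  \<open>c\<close>, so no smaller bound is possible. The initial values differ by at most
  \<open>c / \<alpha>\<close>, and
  \<open>exp (- \<alpha> * t) * (1 + (exp (\<alpha> * t) - 1)) = 1\<close>.\<close>

lemma periodic_response_diff_le:
  fixes \<phi> \<psi> :: "real \<Rightarrow> real"
  assumes "\<alpha> > 0" "T > 0" "t \<in> {0..T}"
    and \<phi>: "(\<lambda>s. exp (\<alpha> * s) * \<phi> s) integrable_on {0..T}"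
    and \<psi>: "(\<lambda>s. exp (\<alpha> * s) * \<psi> s) integrable_on {0..T}"
    and c: "\<And>s. s \<in> {0..T} \<Longrightarrow> \<bar>\<phi> s - \<psi> s\<bar> \<le> c"
  shows "\<bar>periodic_response \<alpha> T \<phi> t - periodic_response \<alpha> T \<psi> t\<bar> \<le> c / \<alpha>"
proof -
  define I where "I \<theta> x = integral {0..x} (\<lambda>s. exp (\<alpha> * s) * \<theta> s)" for \<theta> x
  have I: "\<bar>I \<phi> x - I \<psi> x\<bar> \<le> c / \<alpha> * (exp (\<alpha> * x) - 1)" if "x \<in> {0..T}" for x
    unfolding I_def using exp_weighted_integral_diff_le [OF \<open>\<alpha> > 0\<close> that \<phi> \<psi> c] by blast
  have pos: "exp (\<alpha> * T) - 1 > 0"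
    using assms by simp
  have "\<bar>I \<phi> T / (exp (\<alpha> * T) - 1) - I \<psi> T / (exp (\<alpha> * T) - 1)\<bar> = \<bar>I \<phi> T - I \<psi> T\<bar> / (exp (\<alpha> * T) - 1)"
    using pos by (simp flip: diff_divide_distrib)
  also have "\<dots> \<le> c / \<alpha>"
    using I [of T] pos \<open>T > 0\<close> by (simp add: pos_divide_le_eq)
  finally have init: "\<bar>I \<phi> T / (exp (\<alpha> * T) - 1) - I \<psi> T / (exp (\<alpha> * T) - 1)\<bar> \<le> c / \<alpha>" .
  have "periodic_response \<alpha> T \<phi> t - periodic_response \<alpha> T \<psi> t =
      exp (- \<alpha> * t) * ((I \<phi> T / (exp (\<alpha> * T) - 1) - I \<psi> T / (exp (\<alpha> * T) - 1)) + (I \<phi> t - I \<psi> t))"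
    by (simp add: periodic_response_def I_def algebra_simps)
  also have "\<bar>\<dots>\<bar> \<le> exp (- \<alpha> * t) * (c / \<alpha> + c / \<alpha> * (exp (\<alpha> * t) - 1))"
    unfolding abs_mult abs_exp_cancel
    using order_trans [OF abs_triangle_ineq add_mono [OF init I [OF \<open>t \<in> {0..T}\<close>]]]
    by (rule mult_left_mono) simp
  also have "\<dots> = c / \<alpha>"
    by (simp add: algebra_simps flip: exp_add)
  finally show ?thesis .
qed

text \<open>With \<open>E = exp (\<alpha> * T)\<close> and \<open>I\<close> the full weighted
  integral, this is the identity \<open>(I / (E - 1) + I) / E = I / (E - 1)\<close>.\<close>

lemma periodic_response_periodic:
  assumes "\<alpha> > 0" "T > 0"
  shows "periodic_response \<alpha> T \<phi> 0 = periodic_response \<alpha> T \<phi> T"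
proof -
  define I where "I = integral {0..T} (\<lambda>s. exp (\<alpha> * s) * \<phi> s)"
  define E where "E = exp (\<alpha> * T)"
  have E: "exp (- \<alpha> * T) = 1 / E" "E > 0" "E - 1 > 0"
    using assms by (auto simp: E_def exp_minus inverse_eq_divide)
  have "periodic_response \<alpha> T \<phi> T = 1 / E * (I / (E - 1) + I)"
    by (simp add: periodic_response_def I_def E(1) [symmetric]) (simp add: E_def)
  also have "\<dots> = I / (E - 1)"
    using E by (simp add: field_simps)
  finally show ?thesis
    by (simp add: periodic_response_def I_def E_def)
qed

text \<open>Bounded forcing makes the indefinite integral Lipschitz; the exponential factor is
  Lipschitz as well, and products preserve absolute continuity.\<close>

lemma periodic_response_abs_continuous_on:
  fixes \<phi> :: "real \<Rightarrow> real"
  assumes \<phi>: "\<phi> \<in> borel_measurable (lebesgue_on {0..T})" "\<And>t. t \<in> {0..T} \<Longrightarrow> \<bar>\<phi> t\<bar> \<le> B" and "\<alpha> > 0"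
  shows "abs_continuous_on {0..T} (periodic_response \<alpha> T \<phi>)"
proof -
  define \<psi> where "\<psi> s = exp (\<alpha> * s) * \<phi> s" for s
  have int: "\<psi> integrable_on {0..T}"
    unfolding \<psi>_def by (rule exp_weighted_integrable_on [OF \<phi>])
  \<comment> \<open>The weight is largest at \<open>T\<close>; taking \<open>\<bar>B\<bar>\<close>
    makes \<open>L\<close> nonnegative even if the interval is empty.\<close>
  define L where "L = exp (\<alpha> * T) * \<bar>B\<bar>"
  have bound: "\<bar>\<psi> s\<bar> \<le> L" if "s \<in> {0..T}" for s
    unfolding \<psi>_def L_def abs_mult
    using \<phi>(2) [OF that] that \<open>\<alpha> > 0\<close> by (intro mult_mono) auto
  have "L-lipschitz_on {0..T} (\<lambda>t. C + integral {0..t} \<psi>)" for C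
  proof (rule lipschitz_onI)
    have *: "\<bar>integral {0..y} \<psi> - integral {0..x} \<psi>\<bar> \<le> L * (y - x)" if "0 \<le> x" "x \<le> y" "y \<le> T" for x y
    proof -
      have "integral {0..x} \<psi> + integral {x..y} \<psi> = integral {0..y} \<psi>"
        using that int
        by (intro Henstock_Kurzweil_Integration.integral_combine) (auto intro: integrable_subinterval_real)
      moreover have "norm (integral {x..y} \<psi>) \<le> L * (y - x)"
      proof -
        have "norm (integral {x..y} \<psi>) \<le> integral {x..y} (\<lambda>_. L)"
          using that int bound
          by (intro Henstock_Kurzweil_Integration.integral_norm_bound_integral)
             (auto intro: integrable_subinterval_real)
        then show ?thesis
          using that by (simp add: mult.commute)
      qed
      ultimately show ?thesis by (simp add: algebra_simps)
    qed
    fix x y assume "x \<in> {0..T}" "y \<in> {0..T}"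
    then show "dist (C + integral {0..x} \<psi>) (C + integral {0..y} \<psi>) \<le> L * dist x y"
      using * [of x y] * [of y x] by (cases "x \<le> y") (auto simp: dist_real_def abs_minus_commute)
  qed (simp add: L_def)
  then have 1: "abs_continuous_on {0..T} (\<lambda>t. C + integral {0..t} \<psi>)" for C
    by (rule lipschitz_on_imp_abs_continuous_on)
  have "\<alpha>-lipschitz_on {0..T} (\<lambda>t. exp (- \<alpha> * t))"
  proof (rule lipschitz_onI)
    fix x y assume "x \<in> {0..T}" "y \<in> {0..T}"
    then show "dist (exp (- \<alpha> * x)) (exp (- \<alpha> * y)) \<le> \<alpha> * dist x y"
      unfolding dist_norm
    proof (intro field_differentiable_bound [where f' = "\<lambda>t. - \<alpha> * exp (- \<alpha> * t)"])
      show "((\<lambda>t. exp (- \<alpha> * t)) has_real_derivative - \<alpha> * exp (- \<alpha> * t)) (at t within {0..T})" for t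
        by (auto intro!: derivative_eq_intros)
      show "norm (- \<alpha> * exp (- \<alpha> * t)) \<le> \<alpha>" if "t \<in> {0..T}" for t
        using that \<open>\<alpha> > 0\<close> by (simp add: abs_mult)
    qed auto
  qed (use \<open>\<alpha> > 0\<close> in simp)
  then have "abs_continuous_on {0..T} (\<lambda>t. exp (- \<alpha> * t))"
    by (rule lipschitz_on_imp_abs_continuous_on)
  from abs_continuous_on_mult [OF this 1] show ?thesis
    unfolding periodic_response_def \<psi>_def .
qed

lemma periodic_response_has_derivative_AE:
  fixes \<phi> :: "real \<Rightarrow> real"
  assumes \<phi>: "(\<lambda>s. exp (\<alpha> * s) * \<phi> s) integrable_on {0..T}"
  shows "AE t in lebesgue_on {0..T}.
    (periodic_response \<alpha> T \<phi> has_real_derivative \<phi> t - \<alpha> * periodic_response \<alpha> T \<phi> t) (at t within {0..T})"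
proof -
  let ?I = "\<lambda>t. integral {0..t} (\<lambda>s. exp (\<alpha> * s) * \<phi> s)"
  have "AE t in lebesgue_on {0..T}. (?I has_real_derivative exp (\<alpha> * t) * \<phi> t) (at t within {0..T})"
    using negligible_integral_not_has_real_derivative [OF \<phi>] by (simp add: AE_lebesgue_on_iff_negligible)
  then show ?thesis
  proof (rule AE_mp, intro AE_I2 impI)
    fix t assume I: "(?I has_real_derivative exp (\<alpha> * t) * \<phi> t) (at t within {0..T})"
    define C where "C = ?I T / (exp (\<alpha> * T) - 1)"
    have E: "((\<lambda>t. exp (- \<alpha> * t)) has_real_derivative - \<alpha> * exp (- \<alpha> * t)) (at t within {0..T})"
      by (auto intro!: derivative_eq_intros)
    have response: "periodic_response \<alpha> T \<phi> x = exp (- \<alpha> * x) * (C + ?I x)" for x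
      by (simp add: periodic_response_def C_def)
    have "((\<lambda>x. exp (- \<alpha> * x) * (C + ?I x)) has_real_derivative
        - \<alpha> * exp (- \<alpha> * t) * (C + ?I t) + (0 + exp (\<alpha> * t) * \<phi> t) * exp (- \<alpha> * t)) (at t within {0..T})"
      by (rule DERIV_mult [OF E DERIV_add [OF DERIV_const I]])
    also have "- \<alpha> * exp (- \<alpha> * t) * (C + ?I t) + (0 + exp (\<alpha> * t) * \<phi> t) * exp (- \<alpha> * t) =
        \<phi> t - \<alpha> * periodic_response \<alpha> T \<phi> t"
      by (simp add: response exp_minus)
    finally show "(periodic_response \<alpha> T \<phi> has_real_derivative \<phi> t - \<alpha> * periodic_response \<alpha> T \<phi> t)
        (at t within {0..T})"
      by (simp only: response [abs_def, symmetric] response [symmetric])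
  qed
qed

section \<open>Existence by contraction\<close>

text \<open>Boundedness at \<open>s = 0\<close> spreads through \<open>lip\<close> to the forcing
  along any bounded \<open>u\<close>, so the linear theory for bounded measurable forcing applies at
  every step of the iteration.\<close>

lemma periodic_solution_exists:
  assumes "T > 0" "\<alpha> > 0" "0 \<le> k" "k < \<alpha>" and f: "caratheodory_on {0..T} f"
    and bdd: "bounded ((\<lambda>t. f t 0) ` {0..T})"
    and lip: "\<And>t s1 s2. t \<in> {0..T} \<Longrightarrow> \<bar>(f t s2 + \<alpha> * s2) - (f t s1 + \<alpha> * s1)\<bar> \<le> k * \<bar>s2 - s1\<bar>"
  shows "\<exists>u. periodic_solution T f u"
proof -
  define \<phi> where "\<phi> u t = f t (u t) + \<alpha> * u t" for u t
  define R where "R u = periodic_response \<alpha> T (\<phi> u)" for u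
  obtain M where M: "\<forall>t\<in>{0..T}. \<bar>f t 0\<bar> \<le> M"
    using bdd unfolding bounded_iff by auto
  have bound: "\<bar>\<phi> u t\<bar> \<le> M + k * norm u" if "t \<in> {0..T}" for u :: "real \<Rightarrow>\<^sub>C real" and t
  proof -
    have "\<bar>\<phi> u t\<bar> \<le> \<bar>f t 0\<bar> + k * \<bar>u t\<bar>"
      using lip [OF that, of "u t" 0] by (simp add: \<phi>_def)
    also have "\<dots> \<le> M + k * norm u"
      using bspec [OF M that] norm_bounded [of u t] \<open>0 \<le> k\<close> by (intro add_mono mult_left_mono) auto
    finally show ?thesis .
  qed
  have meas: "\<phi> u \<in> borel_measurable (lebesgue_on {0..T})" for u :: "real \<Rightarrow>\<^sub>C real"
  proof -
    have u: "apply_bcontfun u \<in> borel_measurable (lebesgue_on {0..T})"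
      by (intro continuous_imp_measurable_on_sets_lebesgue) auto
    have "(\<lambda>t. f t (u t)) \<in> borel_measurable (lebesgue_on {0..T})"
      by (rule caratheodory_on_compose_measurable [OF f u])
    with u show ?thesis
      unfolding \<phi>_def by measurable
  qed
  have int: "(\<lambda>s. exp (\<alpha> * s) * \<phi> u s) integrable_on {0..T}" for u :: "real \<Rightarrow>\<^sub>C real"
    using exp_weighted_integrable_on [OF meas bound] by blast
  have ac: "abs_continuous_on {0..T} (R u)" for u :: "real \<Rightarrow>\<^sub>C real"
    unfolding R_def using periodic_response_abs_continuous_on [OF meas bound \<open>\<alpha> > 0\<close>] by blast
  \<comment> \<open>The complete space used is that of bounded continuous functions on the whole
    line; clamping extends \<open>R u\<close> constantly beyond the interval without enlarging
    distances.\<close>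
  have "\<exists>v :: real \<Rightarrow>\<^sub>C real. \<forall>x. v x = R u (clamp 0 T x)" for u :: "real \<Rightarrow>\<^sub>C real"
  proof -
    have "continuous_on (cbox 0 T) (R u)"
      using abs_continuous_on_imp_continuous_on [OF ac] by simp
    then show ?thesis
      by (rule continuous_on_cbox_bcontfunE) blast
  qed
  then obtain A :: "(real \<Rightarrow>\<^sub>C real) \<Rightarrow> (real \<Rightarrow>\<^sub>C real)" where A: "\<And>u x. A u x = R u (clamp 0 T x)"
    by metis
  have "dist (A u) (A v) \<le> k / \<alpha> * dist u v" for u v
  proof (rule dist_bound)
    fix x
    have "clamp 0 T x \<in> {0..T}"
      using clamp_in_interval [of 0 T x] \<open>T > 0\<close> by simp
    moreover have "\<bar>\<phi> u s - \<phi> v s\<bar> \<le> k * dist u v" if "s \<in> {0..T}" for s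
    proof -
      have "\<bar>\<phi> u s - \<phi> v s\<bar> \<le> k * \<bar>u s - v s\<bar>"
        using lip [OF that] by (simp add: \<phi>_def)
      also have "\<dots> \<le> k * dist u v"
        using dist_bounded [of u s v] \<open>0 \<le> k\<close> by (intro mult_left_mono) (auto simp: dist_real_def)
      finally show ?thesis .
    qed
    ultimately have "\<bar>R u (clamp 0 T x) - R v (clamp 0 T x)\<bar> \<le> k * dist u v / \<alpha>"
      unfolding R_def using assms(1,2) int by (intro periodic_response_diff_le)
    then show "dist (A u x) (A v x) \<le> k / \<alpha> * dist u v"
      by (simp add: A dist_real_def)
  qed
  then obtain u where "A u = u"
    using banach_fix_type [of "k / \<alpha>" A] assms by auto
  have fixed: "u t = R u t" if "t \<in> {0..T}" for t
    using A [of u t] \<open>A u = u\<close> clamp_cancel_cbox [of t 0 T] that by simp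
  \<comment> \<open>\<open>R u\<close> agrees with the fixed point on the interval and already
    carries the regularity and the derivative; replacing \<open>u t\<close> by \<open>R u t\<close>
    turns \<open>\<phi> u t - \<alpha> * R u t\<close> into \<open>f t (R u t)\<close>.\<close>
  have "periodic_solution T f (R u)"
    unfolding periodic_solution_def
  proof (intro conjI)
    show "abs_continuous_on {0..T} (R u)" by (rule ac)
    show "R u 0 = R u T"
      unfolding R_def using assms by (intro periodic_response_periodic)
    have "AE t in lebesgue_on {0..T}. (R u has_real_derivative \<phi> u t - \<alpha> * R u t) (at t within {0..T})"
      unfolding R_def by (rule periodic_response_has_derivative_AE [OF int])
    then show "AE t in lebesgue_on {0..T}. (R u has_real_derivative f t (R u t)) (at t within {0..T})"
      by (rule AE_mp, intro AE_I2 impI) (simp add: \<phi>_def fixed)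
  qed
  then show ?thesis by blast
qed

theorem theorem5p2:
  fixes T \<alpha> :: real
    and f :: "real \<Rightarrow> real \<Rightarrow> real"
    and h :: "real \<Rightarrow> real"
  assumes "T > 0"
    and "caratheodory_on {0..T} f"
    and "\<And>s. bounded ((\<lambda>t. f t s) ` {0..T})"
    and "\<alpha> > 0"
    and "\<And>t. t \<in> {0..T} \<Longrightarrow> h t > 0"
    and "bdd_above (h ` {0..T})"
    and "(SUP t\<in>{0..T}. h t) < \<alpha>"
    and "\<And>t s1 s2. t \<in> {0..T} \<Longrightarrow> s1 \<le> s2 \<Longrightarrow>
           0 \<le> f t s2 + \<alpha> * s2 - (f t s1 + \<alpha> * s1) \<and>
           f t s2 + \<alpha> * s2 - (f t s1 + \<alpha> * s1) \<le> h t * (s2 - s1)"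
    and "\<exists>w. periodic_lower_solution T f w"
  shows "\<exists>u. periodic_solution T f u \<and>
           (\<forall>v. periodic_solution T f v \<longrightarrow> (\<forall>t\<in>{0..T}. v t = u t))"
proof -
  define k where "k = (SUP t\<in>{0..T}. h t)"
  have hk: "h t \<le> k" if "t \<in> {0..T}" for t
    unfolding k_def using assms(6) that by (rule cSUP_upper [rotated])
  have "0 < k"
    using assms(5) [of 0] hk [of 0] \<open>T > 0\<close> by simp
  have "k < \<alpha>"
    using assms(7) by (simp add: k_def)
  have inc: "0 \<le> f t s2 + \<alpha> * s2 - (f t s1 + \<alpha> * s1)"
      "f t s2 + \<alpha> * s2 - (f t s1 + \<alpha> * s1) \<le> k * (s2 - s1)" if "t \<in> {0..T}" "s1 \<le> s2" for t s1 s2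
    using assms(8) [OF that] hk [OF that(1)] that(2) mult_right_mono [of "h t" k "s2 - s1"] by auto
  have lip: "\<bar>(f t s2 + \<alpha> * s2) - (f t s1 + \<alpha> * s1)\<bar> \<le> k * \<bar>s2 - s1\<bar>" if "t \<in> {0..T}" for t s1 s2
    using inc [OF that, of s1 s2] inc [OF that, of s2 s1] by (cases "s1 \<le> s2") auto
  obtain u where u: "periodic_solution T f u"
    using periodic_solution_exists [OF assms(1,4) _ \<open>k < \<alpha>\<close> assms(2,3) lip] \<open>0 < k\<close> by auto
  \<comment> \<open>Moving the linear term to the right turns the upper Lipschitz bound into
    dissipativity with the positive rate \<open>\<alpha> - k\<close>.\<close>
  have "f t s2 - f t s1 \<le> - (\<alpha> - k) * (s2 - s1)" if "t \<in> {0..T}" "s1 \<le> s2" for t s1 s2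
    using inc(2) [OF that] by (simp add: algebra_simps)
  then have "v t = u t" if "periodic_solution T f v" "t \<in> {0..T}" for v t
    using periodic_solution_unique [of T "\<alpha> - k" f v u t] assms(1) \<open>k < \<alpha>\<close> u that by simp
  then show ?thesis
    by (intro exI [of _ u] conjI allI impI ballI u)
qed

end
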